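(* There is a linear-time algorithm which, given words $c_1,\dots,c_k$ in the alphabet $\{a^{\pm1},t^{\pm1}\}$, decides whether there exist $x,y,z_1,\dots,z_k\in L_2$ such that $$x^2y^2\prod_{i=1}^k z_i^{-1}c_iz_i=1\quad\text{in } L_2.$$ (That is, the Diophantine problem for non-orientable quadratic equations of genus two over the lamplighter group $L_2$ is decidable in linear time.)
   Context: Let $\mathbb{Z}_2^{\mathbb{Z}}$ denote the abelian group of finitely supported functions $f:\mathbb{Z}\to\mathbb{Z}_2$ under pointwise addition, and for $b\in\mathbb{Z}$ put $f^b(x)=f(x+b)$. The lamplighter group is $L_2=\mathbb{Z}\ltimes\mathbb{Z}_2^{\mathbb{Z}}$, the set of pairs $(\delta,f)$ with product $(\delta_1,f_1)(\delta_2,f_2)=(\delta_1+\delta_2,\,f_1^{\delta_2}+f_2)$. It is generated by $a=(0,\mathbf 1_0)$, where $\mathbf 1_0$ is the indicator function of $\{0\}$, and $t=(1,0)$. Elements of $L_2$ are given as words in $a^{\pm1},t^{\pm1}$. The model of computation is a random-access machine. The size of the input is the length of the left-hand side of the equation. *)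

theory Defs
  imports "HOL-Algebra.Group" "HOL-Library.Z2"
begin

definition shift :: "int \<Rightarrow> (int \<Rightarrow> bit) \<Rightarrow> (int \<Rightarrow> bit)" where
  "shift b f = (\<lambda>x. f (x + b))"

definition L2 :: "(int \<times> (int \<Rightarrow> bit)) monoid" where
  "L2 = \<lparr>carrier = {(\<delta>, f). finite {x. f x \<noteq> 0}},
         mult = (\<lambda>(\<delta>\<^sub>1, f\<^sub>1) (\<delta>\<^sub>2, f\<^sub>2). (\<delta>\<^sub>1 + \<delta>\<^sub>2, \<lambda>x. shift \<delta>\<^sub>2 f\<^sub>1 x + f\<^sub>2 x)),
         one = (0, \<lambda>x. 0)\<rparr>"

lemma finite_support_shift:
  assumes "finite {x. f x \<noteq> 0}"
  shows "finite {x. shift b f x \<noteq> 0}"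
proof -
  have "{x. shift b f x \<noteq> 0} = (\<lambda>x. x - b) ` {x. f x \<noteq> 0}"
    by (force simp: shift_def image_iff intro: exI[of _ "_ + b"])
  then show ?thesis using assms by simp
qed

lemma finite_support_add:
  fixes f g :: "int \<Rightarrow> bit"
  assumes "finite {x. f x \<noteq> 0}" and "finite {x. g x \<noteq> 0}"
  shows "finite {x. f x + g x \<noteq> 0}"
  by (rule finite_subset[OF _ finite_UnI[OF assms]]) auto

lemma group_L2: "group L2"
proof (rule groupI)
  fix p q assume "p \<in> carrier L2" "q \<in> carrier L2"
  then show "p \<otimes>\<^bsub>L2\<^esub> q \<in> carrier L2"
    by (cases p; cases q)
       (simp add: L2_def finite_support_add finite_support_shift
             del: add_bit_eq_xor bit_not_zero_iff)
next
  fix p q r assume "p \<in> carrier L2" "q \<in> carrier L2" "r \<in> carrier L2"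
  then show "p \<otimes>\<^bsub>L2\<^esub> q \<otimes>\<^bsub>L2\<^esub> r = p \<otimes>\<^bsub>L2\<^esub> (q \<otimes>\<^bsub>L2\<^esub> r)"
    by (auto simp: L2_def shift_def add.assoc add.commute add.left_commute
             simp del: add_bit_eq_xor)
next
  fix p assume p: "p \<in> carrier L2"
  obtain \<delta> f where pf: "p = (\<delta>, f)" by (cases p)
  have "(- \<delta>, shift (- \<delta>) f) \<in> carrier L2"
    using p pf finite_support_shift[of f "- \<delta>"] by (simp add: L2_def)
  moreover have "(- \<delta>, shift (- \<delta>) f) \<otimes>\<^bsub>L2\<^esub> p = \<one>\<^bsub>L2\<^esub>"
  proof -
    have "b + b = 0" for b :: bit by (cases b) simp_all
    then show ?thesis by (simp add: L2_def pf shift_def del: add_bit_eq_xor)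
  qed
  ultimately show "\<exists>q\<in>carrier L2. q \<otimes>\<^bsub>L2\<^esub> p = \<one>\<^bsub>L2\<^esub>" by blast
qed (auto simp: L2_def shift_def)

definition lamp_a :: "int \<times> (int \<Rightarrow> bit)" where
  "lamp_a = (0, \<lambda>x. if x = 0 then 1 else 0)"

definition lamp_t :: "int \<times> (int \<Rightarrow> bit)" where
  "lamp_t = (1, \<lambda>x. 0)"

datatype letter = A | A_inv | T | T_inv

primrec letter_val :: "letter \<Rightarrow> int \<times> (int \<Rightarrow> bit)" where
  "letter_val A = lamp_a"
| "letter_val A_inv = inv\<^bsub>L2\<^esub> lamp_a"
| "letter_val T = lamp_t"
| "letter_val T_inv = inv\<^bsub>L2\<^esub> lamp_t"

definition list_prod :: "(int \<times> (int \<Rightarrow> bit)) list \<Rightarrow> int \<times> (int \<Rightarrow> bit)" where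
  "list_prod gs = foldr (\<lambda>g h. g \<otimes>\<^bsub>L2\<^esub> h) gs \<one>\<^bsub>L2\<^esub>"

definition word_val :: "letter list \<Rightarrow> int \<times> (int \<Rightarrow> bit)" where
  "word_val w = list_prod (map letter_val w)"

definition genus2_solvable :: "letter list list \<Rightarrow> bool" where
  "genus2_solvable cs \<longleftrightarrow>
     (\<exists>x\<in>carrier L2. \<exists>y\<in>carrier L2. \<exists>zs.
        length zs = length cs \<and> set zs \<subseteq> carrier L2 \<and>
        x [^]\<^bsub>L2\<^esub> (2::nat) \<otimes>\<^bsub>L2\<^esub> y [^]\<^bsub>L2\<^esub> (2::nat) \<otimes>\<^bsub>L2\<^esub>
        list_prod (map2 (\<lambda>z c. inv\<^bsub>L2\<^esub> z \<otimes>\<^bsub>L2\<^esub> word_val c \<otimes>\<^bsub>L2\<^esub> z) zs cs)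
        = \<one>\<^bsub>L2\<^esub>)"

text \<open>The length of the left-hand side as a word: four letters for $x^2y^2$, and
  $|c_i| + 2$ letters for each factor $z_i^{-1} c_i z_i$.\<close>

definition eq_length :: "letter list list \<Rightarrow> nat" where
  "eq_length cs = 4 + (\<Sum>c\<leftarrow>cs. length c + 2)"

text \<open>Random-access machines in the style of Cook and Reckhow: integer registers
  $X_0, X_1, \ldots$, indirect addressing (\<open>Load\<close>, \<open>Store\<close>), addition and subtraction but
  no multiplication, and unit cost per executed instruction. The input is a finite sequence
  of integers consumed by \<open>Read\<close>; when it is exhausted, \<open>Read\<close> yields $0$.\<close>

datatype instr =
    Const nat int
  | Add nat nat nat
  | Sub nat nat nat
  | Load nat nat
  | Store nat nat
  | JumpPos nat nat
  | Read nat
  | Accept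
  | Reject

text \<open>\<open>run P n pc X inp\<close> is the answer given by program \<open>P\<close>, started at instruction \<open>pc\<close> with
  registers \<open>X\<close> and remaining input \<open>inp\<close>, if it halts within \<open>n\<close> executed instructions
  (the halting instruction included). It is \<open>None\<close> if \<open>P\<close> does not halt within \<open>n\<close>
  instructions, leaves the program text, or uses a negative address.\<close>

primrec run :: "instr list \<Rightarrow> nat \<Rightarrow> nat \<Rightarrow> (nat \<Rightarrow> int) \<Rightarrow> int list \<Rightarrow> bool option" where
  "run P 0 pc X inp = None"
| "run P (Suc n) pc X inp =
     (if pc \<ge> length P then None else
      case P ! pc of
        Const i c \<Rightarrow> run P n (pc + 1) (X(i := c)) inp
      | Add i j k \<Rightarrow> run P n (pc + 1) (X(i := X j + X k)) inp
      | Sub i j k \<Rightarrow> run P n (pc + 1) (X(i := X j - X k)) inp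
      | Load i j \<Rightarrow> if X j < 0 then None else run P n (pc + 1) (X(i := X (nat (X j)))) inp
      | Store i j \<Rightarrow> if X i < 0 then None else run P n (pc + 1) (X(nat (X i) := X j)) inp
      | JumpPos i l \<Rightarrow> run P n (if X i > 0 then l else pc + 1) X inp
      | Read i \<Rightarrow> run P n (pc + 1) (X(i := (case inp of [] \<Rightarrow> 0 | s # _ \<Rightarrow> s))) (tl inp)
      | Accept \<Rightarrow> Some True
      | Reject \<Rightarrow> Some False)"

definition linear_time_decidable ::
    "('a \<Rightarrow> int list) \<Rightarrow> ('a \<Rightarrow> nat) \<Rightarrow> ('a \<Rightarrow> bool) \<Rightarrow> bool" where
  "linear_time_decidable enc sz Q \<longleftrightarrow>
     (\<exists>P C. \<forall>x. run P (C * sz x) 0 (\<lambda>_. 0) (enc x) = Some (Q x))"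

primrec letter_code :: "letter \<Rightarrow> int" where
  "letter_code A = 1"
| "letter_code A_inv = 2"
| "letter_code T = 3"
| "letter_code T_inv = 4"

text \<open>The words are written one after the other, each terminated by the symbol $5$; all
  symbols are nonzero, so that reading $0$ signals the end of the input.\<close>

definition encode :: "letter list list \<Rightarrow> int list" where
  "encode cs = concat (map (\<lambda>c. map letter_code c @ [5]) cs)"

end

theory Submission
  imports Defs
begin

text \<open>Both the exponent sum of \<open>t\<close> and the number of lit lamps are, modulo 2, homomorphisms from
  \<open>L2\<close> to the group of order two. They vanish on squares and are invariant under conjugation, so
  they must vanish on \<open>\<Prod>c\<^sub>i\<close> if the equation is solvable. Conversely, an element \<open>(2 m, f)\<close> with an
  even number of lit lamps is of the form \<open>x\<^sup>2 y\<^sup>2\<close> with \<open>x = (1, g)\<close> and \<open>y = (m - 1, 0)\<close>, because such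
  an \<open>f\<close> is divisible by \<open>1 + s\<close> in the ring of Laurent polynomials over the field with two elements.
  Hence the equation is solvable iff the \<open>c\<^sub>i\<close> together contain an even number of letters \<open>a\<^sup>\<plusminus>\<^sup>1\<close>
  and an even number of letters \<open>t\<^sup>\<plusminus>\<^sup>1\<close>.\<close>

section \<open>Arithmetic of bits and the group law of \<open>L2\<close>\<close>

declare add_bit_eq_xor [simp del]

interpretation L2: group L2
  by (rule group_L2)

lemma bit_add_self [simp]: "b + b = (0 :: bit)"
  by (cases b) simp_all

lemma bit_add_eq_0_iff: "a + b = 0 \<longleftrightarrow> a = (b :: bit)"
  by (cases a; cases b) simp_all

lemma of_int_bit_eq_0_iff: "(of_int n :: bit) = 0 \<longleftrightarrow> even n"
proof (cases "even n")
  case True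
  then obtain k where "n = k + k" by (metis evenE mult_2)
  with True show ?thesis by simp
next
  case False
  then obtain k where "n = k + k + 1" by (metis mult_2 oddE)
  with False show ?thesis by simp
qed

lemma mem_carrier_L2: "(d, f) \<in> carrier L2 \<longleftrightarrow> finite {x. f x \<noteq> 0}"
  by (simp add: L2_def)

lemma mult_L2: "(d, f) \<otimes>\<^bsub>L2\<^esub> (e, g) = (d + e, \<lambda>x. f (x + e) + g x)"
  by (simp add: L2_def shift_def)

lemma one_L2: "\<one>\<^bsub>L2\<^esub> = (0, \<lambda>x. 0)"
  by (simp add: L2_def)

lemma square_L2: "p \<in> carrier L2 \<Longrightarrow> p [^]\<^bsub>L2\<^esub> (2::nat) = p \<otimes>\<^bsub>L2\<^esub> p"
  by (simp add: numeral_2_eq_2)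

text \<open>For finite support this is the augmentation \<open>s = 1\<close> of the Laurent
  polynomial with coefficients \<open>f\<close>.\<close>

definition lamp_sum :: "(int \<Rightarrow> bit) \<Rightarrow> bit" where
  "lamp_sum f = sum f {x. f x \<noteq> 0}"

lemma lamp_sum_superset:
  assumes "finite S" "{x. f x \<noteq> 0} \<subseteq> S"
  shows "lamp_sum f = sum f S"
  unfolding lamp_sum_def using assms by (intro sum.mono_neutral_left) auto

lemma lamp_sum_add:
  assumes "finite {x. f x \<noteq> 0}" "finite {x. g x \<noteq> 0}"
  shows "lamp_sum (\<lambda>x. f x + g x) = lamp_sum f + lamp_sum g"
proof -
  let ?S = "{x. f x \<noteq> 0} \<union> {x. g x \<noteq> 0}"
  have "finite ?S" using assms by blast
  then have "lamp_sum (\<lambda>x. f x + g x) = sum (\<lambda>x. f x + g x) ?S" "lamp_sum f = sum f ?S"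
      "lamp_sum g = sum g ?S"
    by (intro lamp_sum_superset; auto)+
  then show ?thesis by (simp only: sum.distrib)
qed

lemma lamp_sum_shift: "lamp_sum (\<lambda>x. f (x + b)) = lamp_sum f"
  unfolding lamp_sum_def
  by (rule sum.reindex_bij_witness[where i = "\<lambda>x. x - b" and j = "\<lambda>x. x + b"]) auto

section \<open>Division by \<open>1 + s\<close> and products of two squares\<close>

text \<open>Division by \<open>1 + s\<close>: the quotient is the sequence of partial sums.\<close>

lemma obtain_lamp_quotient:
  assumes fin: "finite {x. f x \<noteq> 0}" and sum0: "lamp_sum f = 0"
  obtains g where "finite {x. g x \<noteq> 0}" "\<And>x. g (x + 1) + g x = f x"
proof -
  let ?S = "{x. f x \<noteq> 0}"
  define g where "g x = sum f {y \<in> ?S. y < x}" for x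
  obtain N where N: "\<And>x. x \<in> ?S \<Longrightarrow> \<bar>x\<bar> < N"
  proof
    show "\<bar>x\<bar> < (\<Sum>y\<in>?S. \<bar>y\<bar>) + 1" if "x \<in> ?S" for x
      using member_le_sum[OF that, of abs] fin by simp
  qed
  \<comment> \<open>Left of the support the partial sum is empty; right of it, it is the full sum,
    which vanishes by \<open>sum0\<close>.\<close>
  have "g x = 0" if "x \<notin> {-N..N}" for x
  proof (cases "x < -N")
    case True
    then have "{y \<in> ?S. y < x} = {}" using N by fastforce
    then show ?thesis by (simp only: g_def sum.empty)
  next
    case False
    then have "{y \<in> ?S. y < x} = ?S" using N that by fastforce
    then show ?thesis using sum0 by (simp only: g_def lamp_sum_def)
  qed
  then have "{x. g x \<noteq> 0} \<subseteq> {-N..N}" by blast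
  then have "finite {x. g x \<noteq> 0}" by (rule finite_subset) simp
  \<comment> \<open>Passing from \<open>x\<close> to \<open>x + 1\<close> adds the term
    \<open>f x\<close> if \<open>x\<close> is in the support and nothing otherwise; the rest cancels
    in characteristic two.\<close>
  moreover have "g (x + 1) + g x = f x" for x
  proof (cases "x \<in> ?S")
    case True
    then have "{y \<in> ?S. y < x + 1} = insert x {y \<in> ?S. y < x}"
      unfolding zless_add1_eq by blast
    then have "g (x + 1) = f x + g x"
      using fin by (simp only: g_def) (subst sum.insert; simp)
    then show ?thesis by (simp add: add.assoc)
  next
    case False
    then have "{y \<in> ?S. y < x + 1} = {y \<in> ?S. y < x}"
      unfolding zless_add1_eq by blast
    then have "g (x + 1) = g x" by (simp only: g_def)
    then show ?thesis using False by simp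
  qed
  ultimately show thesis by (rule that)
qed

lemma obtain_square_product:
  assumes p: "p \<in> carrier L2" and ev: "even (fst p)" and sum0: "lamp_sum (snd p) = 0"
  obtains x y where "x \<in> carrier L2" "y \<in> carrier L2"
    "x [^]\<^bsub>L2\<^esub> (2::nat) \<otimes>\<^bsub>L2\<^esub> y [^]\<^bsub>L2\<^esub> (2::nat) = p"
proof -
  obtain m f where pf: "p = (2 * m, f)" using ev by (cases p) (auto elim: evenE)
  \<comment> \<open>Squaring \<open>(1, g)\<close> gives the lamps \<open>g (x + 1) + g x\<close>,
    and the right factor \<open>y^2\<close> shifts them by \<open>b\<close>. So \<open>g\<close> has
    to come from \<open>f\<close> shifted back by \<open>b\<close>.\<close>
  define b where "b = 2 * (m - 1)"
  have fin: "finite {x. f (x + - b) \<noteq> 0}"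
    using p finite_support_shift[of f "- b"] by (simp add: pf mem_carrier_L2 shift_def)
  have "lamp_sum (\<lambda>x. f (x + - b)) = 0"
    using sum0 lamp_sum_shift[of f "- b"] by (simp add: pf)
  then obtain g where g: "finite {x. g x \<noteq> 0}" "\<And>x. g (x + 1) + g x = f (x + - b)"
    using obtain_lamp_quotient[OF fin] by blast
  have xy: "(1, g) \<in> carrier L2" "(m - 1, \<lambda>x. 0) \<in> carrier L2"
    using g(1) by (simp_all add: mem_carrier_L2)
  have "g (x + b + 1) + g (x + b) = f x" for x
    using g(2)[of "x + b"] by simp
  then have "(1, g) [^]\<^bsub>L2\<^esub> (2::nat) \<otimes>\<^bsub>L2\<^esub> (m - 1, \<lambda>x. 0) [^]\<^bsub>L2\<^esub> (2::nat) = p"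
    by (simp add: square_L2 xy mult_L2 pf b_def algebra_simps)
  with xy show thesis by (rule that)
qed

section \<open>Values of words and parity homomorphisms\<close>

lemma list_prod_simps [simp]:
  "list_prod [] = \<one>\<^bsub>L2\<^esub>" "list_prod (g # gs) = g \<otimes>\<^bsub>L2\<^esub> list_prod gs"
  by (simp_all add: list_prod_def)

lemma list_prod_closed: "set gs \<subseteq> carrier L2 \<Longrightarrow> list_prod gs \<in> carrier L2"
  by (induction gs) auto

lemma lamp_a_closed: "lamp_a \<in> carrier L2"
  by (simp add: lamp_a_def mem_carrier_L2)

lemma lamp_t_closed: "lamp_t \<in> carrier L2"
  by (simp add: lamp_t_def mem_carrier_L2)

lemma letter_val_closed: "letter_val l \<in> carrier L2"
  by (cases l) (simp_all add: lamp_a_closed lamp_t_closed)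

lemma word_val_closed: "word_val w \<in> carrier L2"
  unfolding word_val_def by (rule list_prod_closed) (auto intro: letter_val_closed)

text \<open>Treats the exponent sum of \<open>t\<close> and the lamp count at once. Additivity is
  asked on the carrier only, since the lamp count needs finite supports.\<close>

locale parity_hom =
  fixes h :: "int \<times> (int \<Rightarrow> bit) \<Rightarrow> bit"
  assumes mult: "\<lbrakk>p \<in> carrier L2; q \<in> carrier L2\<rbrakk> \<Longrightarrow> h (p \<otimes>\<^bsub>L2\<^esub> q) = h p + h q"
begin

lemma one [simp]: "h \<one>\<^bsub>L2\<^esub> = 0"
  using mult[of "\<one>\<^bsub>L2\<^esub>" "\<one>\<^bsub>L2\<^esub>"] by simp

lemma inv: "p \<in> carrier L2 \<Longrightarrow> h (inv\<^bsub>L2\<^esub> p) = h p"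
  using mult[of "inv\<^bsub>L2\<^esub> p" p] by (simp add: bit_add_eq_0_iff)

lemma square: "p \<in> carrier L2 \<Longrightarrow> h (p [^]\<^bsub>L2\<^esub> (2::nat)) = 0"
  by (simp add: square_L2 mult)

lemma conjugate:
  "\<lbrakk>z \<in> carrier L2; p \<in> carrier L2\<rbrakk> \<Longrightarrow> h (inv\<^bsub>L2\<^esub> z \<otimes>\<^bsub>L2\<^esub> p \<otimes>\<^bsub>L2\<^esub> z) = h p"
  by (simp add: mult inv add.commute add.left_commute)

lemma list_prod: "set gs \<subseteq> carrier L2 \<Longrightarrow> h (list_prod gs) = sum_list (map h gs)"
  by (induction gs) (simp_all add: mult list_prod_closed)

lemma word_val: "h (word_val w) = (\<Sum>l\<leftarrow>w. h (letter_val l))"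
proof -
  have "set (map letter_val w) \<subseteq> carrier L2" by (auto intro: letter_val_closed)
  then show ?thesis by (simp add: word_val_def list_prod o_def)
qed

lemma list_prod_words:
  "h (list_prod (map word_val cs)) = (\<Sum>l\<leftarrow>concat cs. h (letter_val l))"
proof -
  have "set (map word_val cs) \<subseteq> carrier L2" by (auto intro: word_val_closed)
  then have "h (list_prod (map word_val cs)) = (\<Sum>c\<leftarrow>cs. h (word_val c))"
    by (simp add: list_prod o_def)
  also have "\<dots> = (\<Sum>l\<leftarrow>concat cs. h (letter_val l))"
    by (induction cs) (simp_all add: word_val)
  finally show ?thesis .
qed

text \<open>Apply \<open>h\<close> to the equation: the squares vanish and each conjugate
  contributes the same as its word.\<close>

lemma solution:
  assumes xy: "x \<in> carrier L2" "y \<in> carrier L2"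
    and zs: "length zs = length cs" "set zs \<subseteq> carrier L2"
    and eq: "x [^]\<^bsub>L2\<^esub> (2::nat) \<otimes>\<^bsub>L2\<^esub> y [^]\<^bsub>L2\<^esub> (2::nat) \<otimes>\<^bsub>L2\<^esub>
        list_prod (map2 (\<lambda>z c. inv\<^bsub>L2\<^esub> z \<otimes>\<^bsub>L2\<^esub> word_val c \<otimes>\<^bsub>L2\<^esub> z) zs cs) = \<one>\<^bsub>L2\<^esub>"
  shows "(\<Sum>l\<leftarrow>concat cs. h (letter_val l)) = 0"
proof -
  let ?ps = "map2 (\<lambda>z c. inv\<^bsub>L2\<^esub> z \<otimes>\<^bsub>L2\<^esub> word_val c \<otimes>\<^bsub>L2\<^esub> z) zs cs"
  have "set ?ps \<subseteq> carrier L2 \<and> sum_list (map h ?ps) = (\<Sum>l\<leftarrow>concat cs. h (letter_val l))"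
    using zs by (induction zs cs rule: list_induct2)
      (simp_all add: word_val_closed conjugate word_val)
  then show ?thesis
    using arg_cong[OF eq, of h] xy
    by (simp add: mult square list_prod list_prod_closed)
qed

end

interpretation shift_parity: parity_hom "\<lambda>p. of_int (fst p)"
  by standard (auto simp: L2_def)

interpretation lamp_parity: parity_hom "\<lambda>p. lamp_sum (snd p)"
proof
  fix p q assume "p \<in> carrier L2" "q \<in> carrier L2"
  moreover have "finite {x. f (x + b) \<noteq> 0}" if "finite {x. f x \<noteq> 0}" for f :: "int \<Rightarrow> bit" and b
    using finite_support_shift[OF that, of b] by (simp add: shift_def)
  ultimately show "lamp_sum (snd (p \<otimes>\<^bsub>L2\<^esub> q)) = lamp_sum (snd p) + lamp_sum (snd q)"
    by (cases p; cases q)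
      (simp add: mult_L2 mem_carrier_L2 lamp_sum_add lamp_sum_shift del: bit_not_zero_iff)
qed

text \<open>A letter and its inverse have equal parity. Phrasing this by codes matches the sums that
  the program computes.\<close>

lemma shift_parity_letter:
  "(of_int (fst (letter_val l)) :: bit) = of_bool (letter_code l \<in> {3, 4})"
  using shift_parity.inv[OF lamp_a_closed] shift_parity.inv[OF lamp_t_closed]
  by (cases l) (simp_all add: lamp_a_def lamp_t_def)

lemma lamp_parity_letter:
  "lamp_sum (snd (letter_val l)) = of_bool (letter_code l \<in> {1, 2})"
  using lamp_parity.inv[OF lamp_a_closed] lamp_parity.inv[OF lamp_t_closed]
  by (cases l) (simp_all add: lamp_a_def lamp_t_def lamp_sum_def)

lemma genus2_solvable_iff:
  "genus2_solvable cs \<longleftrightarrow>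
     (\<Sum>l\<leftarrow>concat cs. of_int (fst (letter_val l)) :: bit) = 0 \<and>
     (\<Sum>l\<leftarrow>concat cs. lamp_sum (snd (letter_val l))) = 0"
    (is "_ \<longleftrightarrow> ?R")
proof
  assume "genus2_solvable cs"
  then show ?R
    unfolding genus2_solvable_def using shift_parity.solution lamp_parity.solution by blast
next
  assume R: ?R
  define w where "w = list_prod (map word_val cs)"
  have w: "w \<in> carrier L2"
    unfolding w_def by (rule list_prod_closed) (auto intro: word_val_closed)
  \<comment> \<open>The squares have to cancel the product \<open>w\<close>, and inversion preserves
    both parities.\<close>
  have "even (fst (inv\<^bsub>L2\<^esub> w))" "lamp_sum (snd (inv\<^bsub>L2\<^esub> w)) = 0"
    using R shift_parity.inv[OF w] lamp_parity.inv[OF w]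
      shift_parity.list_prod_words[of cs] lamp_parity.list_prod_words[of cs]
    by (simp_all add: w_def flip: of_int_bit_eq_0_iff)
  then obtain x y where xy: "x \<in> carrier L2" "y \<in> carrier L2"
    "x [^]\<^bsub>L2\<^esub> (2::nat) \<otimes>\<^bsub>L2\<^esub> y [^]\<^bsub>L2\<^esub> (2::nat) = inv\<^bsub>L2\<^esub> w"
    by (rule obtain_square_product[OF L2.inv_closed[OF w]])
  \<comment> \<open>Trivial conjugators suffice, as \<open>x\<close> and \<open>y\<close> already
    produce the inverse of \<open>w\<close>.\<close>
  let ?zs = "replicate (length cs) \<one>\<^bsub>L2\<^esub>"
  have "map2 (\<lambda>z c. inv\<^bsub>L2\<^esub> z \<otimes>\<^bsub>L2\<^esub> word_val c \<otimes>\<^bsub>L2\<^esub> z) ?zs cs = map word_val cs"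
    by (induction cs) (simp_all add: word_val_closed)
  then have "x [^]\<^bsub>L2\<^esub> (2::nat) \<otimes>\<^bsub>L2\<^esub> y [^]\<^bsub>L2\<^esub> (2::nat) \<otimes>\<^bsub>L2\<^esub>
      list_prod (map2 (\<lambda>z c. inv\<^bsub>L2\<^esub> z \<otimes>\<^bsub>L2\<^esub> word_val c \<otimes>\<^bsub>L2\<^esub> z) ?zs cs) = \<one>\<^bsub>L2\<^esub>"
    using w by (simp add: xy(3) flip: w_def)
  moreover have "length ?zs = length cs" "set ?zs \<subseteq> carrier L2" by auto
  ultimately show "genus2_solvable cs"
    unfolding genus2_solvable_def using xy(1,2) by blast
qed

section \<open>The random-access program and its running time\<close>

text \<open>Registers: 0 holds the current symbol, 1 and 4 the constants 1 and 2, and 2 and 3 the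
  parities of the numbers of letters \<open>a\<^sup>\<plusminus>\<^sup>1\<close> and \<open>t\<^sup>\<plusminus>\<^sup>1\<close> read so far.
  The main loop starts at instruction 2.\<close>

definition parity_program :: "instr list" where
  "parity_program =
    [Const 1 1, Const 4 2,
     Read 0, JumpPos 0 8, JumpPos 2 7, JumpPos 3 7, Accept, Reject,
     Sub 0 0 4, JumpPos 0 12, Sub 2 1 2, JumpPos 1 2,
     Sub 0 0 4, JumpPos 0 2, Sub 3 1 3, JumpPos 1 2]"

definition bit_int :: "bit \<Rightarrow> int" where
  "bit_int b = (if b = 0 then 0 else 1)"

text \<open>Each symbol costs six or eight instructions and the exit at most five. Arbitrary initial
  parities \<open>u\<close> and \<open>v\<close> make the induction go through.\<close>

lemma run_parity_program_loop:
  assumes "set inp \<subseteq> {1..5}" "n \<ge> 8 * length inp + 5"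
    and "X 1 = 1" "X 4 = 2" "X 2 = bit_int u" "X 3 = bit_int v"
  shows "run parity_program n 2 X inp =
    Some (u + (\<Sum>s\<leftarrow>inp. of_bool (s \<in> {1, 2})) = 0 \<and>
          v + (\<Sum>s\<leftarrow>inp. of_bool (s \<in> {3, 4})) = 0)"
  using assms
proof (induction inp arbitrary: n X u v)
  case Nil
  \<comment> \<open>\<open>Read\<close> now yields 0, so control falls through to the tests of the
    two parity registers.\<close>
  then obtain k where "n = 5 + k" using le_Suc_ex by auto
  with Nil show ?case
    by (simp add: parity_program_def numeral_eq_Suc bit_int_def)
next
  case (Cons s inp)
  then obtain k where n: "n = 8 + k" using le_Suc_ex[of 8 n] by auto
  \<comment> \<open>Subtracting a parity register from register 1 flips it. As register 1 stays
    positive, \<open>JumpPos 1 2\<close> always returns to the loop.\<close>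
  have flip: "1 - bit_int b = bit_int (b + 1)" for b
    by (cases b) (simp_all add: bit_int_def)
  have "s \<in> {1..5}" using Cons.prems by simp
  then consider "s \<in> {1, 2}" | "s \<in> {3, 4}" | "s = 5" by fastforce
  then show ?case
  proof cases
    case 1
    let ?X = "X(0 := s - 2, 2 := bit_int (u + 1))"
    have "run parity_program n 2 X (s # inp) = run parity_program (k + 2) 2 ?X inp"
      using 1 Cons.prems by (auto simp: n parity_program_def numeral_eq_Suc flip)
    also have "\<dots> = Some (u + 1 + (\<Sum>s\<leftarrow>inp. of_bool (s \<in> {1, 2})) = 0 \<and>
          v + (\<Sum>s\<leftarrow>inp. of_bool (s \<in> {3, 4})) = 0)"
      using Cons.prems by (intro Cons.IH) (auto simp: n)
    finally show ?thesis using 1 by (auto simp: add.assoc simp del: run.simps)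
  next
    case 2
    let ?X = "X(0 := s - 4, 3 := bit_int (v + 1))"
    have "run parity_program n 2 X (s # inp) = run parity_program k 2 ?X inp"
      using 2 Cons.prems by (auto simp: n parity_program_def numeral_eq_Suc flip)
    also have "\<dots> = Some (u + (\<Sum>s\<leftarrow>inp. of_bool (s \<in> {1, 2})) = 0 \<and>
          v + 1 + (\<Sum>s\<leftarrow>inp. of_bool (s \<in> {3, 4})) = 0)"
      using Cons.prems by (intro Cons.IH) (auto simp: n)
    finally show ?thesis using 2 by (auto simp: add.assoc simp del: run.simps)
  next
    case 3
    \<comment> \<open>A terminator is still positive after both subtractions, so the loop restarts
      with no parity changed; two of the eight budgeted instructions remain.\<close>
    let ?X = "X(0 := s - 4)"
    have "run parity_program n 2 X (s # inp) = run parity_program (k + 2) 2 ?X inp"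
      using 3 Cons.prems by (auto simp: n parity_program_def numeral_eq_Suc)
    also have "\<dots> = Some (u + (\<Sum>s\<leftarrow>inp. of_bool (s \<in> {1, 2})) = 0 \<and>
          v + (\<Sum>s\<leftarrow>inp. of_bool (s \<in> {3, 4})) = 0)"
      using Cons.prems by (intro Cons.IH) (auto simp: n)
    finally show ?thesis using 3 by (auto simp: add.assoc simp del: run.simps)
  qed
qed

lemma symbol_sum_encode:
  fixes g :: "int \<Rightarrow> 'a :: comm_monoid_add"
  assumes "g 5 = 0"
  shows "sum_list (map g (encode cs)) = (\<Sum>l\<leftarrow>concat cs. g (letter_code l))"
  by (induction cs) (simp_all add: encode_def assms o_def)

lemma set_encode: "set (encode cs) \<subseteq> {1..5}"
proof -
  have "letter_code l \<in> {1..5}" for l by (cases l) simp_all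
  then show ?thesis unfolding encode_def by auto
qed

lemma length_encode: "length (encode cs) + 4 \<le> eq_length cs"
  by (induction cs) (simp_all add: encode_def eq_length_def)

theorem proposition5p4:
  "linear_time_decidable encode eq_length genus2_solvable"
proof -
  have "run parity_program (8 * eq_length cs) 0 (\<lambda>_. 0) (encode cs) = Some (genus2_solvable cs)" for cs
  proof -
    \<comment> \<open>The two initial \<open>Const\<close> instructions and the five of the exit fit
      into the slack of \<open>8 * 4\<close> left by \<open>length_encode\<close>.\<close>
    obtain k where k: "8 * eq_length cs = Suc (Suc k)" "k \<ge> 8 * length (encode cs) + 5"
      using length_encode[of cs] by (intro that[of "8 * eq_length cs - 2"]) auto
    let ?X = "(\<lambda>_. 0 :: int)(1 := 1, 4 := 2)"
    have "run parity_program (8 * eq_length cs) 0 (\<lambda>_. 0) (encode cs) =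
        run parity_program k 2 ?X (encode cs)"
      by (simp add: k(1)) (simp add: parity_program_def numeral_2_eq_2)
    also have "\<dots> = Some ((\<Sum>s\<leftarrow>encode cs. of_bool (s \<in> {1, 2}) :: bit) = 0 \<and>
          (\<Sum>s\<leftarrow>encode cs. of_bool (s \<in> {3, 4}) :: bit) = 0)"
      using run_parity_program_loop[OF set_encode k(2), of ?X 0 0] by (simp add: bit_int_def)
    also have "\<dots> = Some (genus2_solvable cs)"
      by (auto simp add: genus2_solvable_iff symbol_sum_encode shift_parity_letter lamp_parity_letter)
    finally show ?thesis .
  qed
  then show ?thesis
    unfolding linear_time_decidable_def by blast
qed

end
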